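(* Let $\alpha>0$, $\beta>0$, $n\ge1$, and take $A=0$, $B=1$, so that $D_n(t)=\frac{1}{n!}\int_{[t,1]^n}\prod_{1\le i<j\le n}(x_j-x_i)^2\prod_{k=1}^n x_k^{\alpha}(1-x_k)^{\beta}\,dx_k$. Then, as $t\to1^-$, $$\frac{D_n(t)}{D_n(0)}\sim 2^{2n\alpha}\,\frac{F(0,\beta)\,K(0,\beta,n)}{F(\alpha,\beta)\,K(\alpha,\beta,n)}\,(1-t)^{n(n+\beta)},$$ (i.e. the ratio of the two sides tends to $1$), where $$F(\alpha,\beta)=\frac{\Gamma\big(\tfrac{\alpha+\beta+1}{2}\big)\,G^2\big(\tfrac{\alpha+\beta+1}{2}\big)\,G^2\big(1+\tfrac{\alpha+\beta}{2}\big)}{G(\alpha+\beta+1)\,G(\alpha+1)\,G(\beta+1)},$$ $$K(\alpha,\beta,n)=\frac{G(n+1)\,G(n+\alpha+1)\,G(n+\beta+1)\,G(n+\alpha+\beta+1)}{G^2\big(n+\tfrac{\alpha+\beta+1}{2}\big)\,G^2\big(n+1+\tfrac{\alpha+\beta}{2}\big)\,\Gamma\big(n+\tfrac{\alpha+\beta+1}{2}\big)}.$$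
   Context: $\Gamma$ is the Gamma function and $G$ is the Barnes $G$-function, defined by $G(x+1)=(2\pi)^{x/2}e^{-(x(x+1)+\gamma x^2)/2}\prod_{k=1}^{\infty}\big[(1+x/k)^k e^{-x+x^2/(2k)}\big]$, with $\gamma$ the Euler–Mascheroni constant. $D_n(0)=\frac1{n!}\int_{[0,1]^n}\prod_{i<j}(x_j-x_i)^2\prod_k x_k^\alpha(1-x_k)^\beta dx_k$; the quotient $D_n(t)/D_n(0)$ is the probability that the smallest eigenvalue of the $n\times n$ Jacobi unitary ensemble with weight $x^\alpha(1-x)^\beta$ on $[0,1]$ is at least $t$. *)

theory Defs
  imports "HOL-Analysis.Analysis"
begin

definition barnesG :: "real \<Rightarrow> real" where
  "barnesG y = (let x = y - 1 in
     (2 * pi) powr (x / 2) * exp (- (x * (x + 1) + euler_mascheroni * x\<^sup>2) / 2) *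
     (\<Prod>k. (1 + x / real (Suc k)) ^ (Suc k) * exp (- x + x\<^sup>2 / (2 * real (Suc k)))))"

definition Dn :: "real \<Rightarrow> real \<Rightarrow> nat \<Rightarrow> real \<Rightarrow> real" where
  "Dn \<alpha> \<beta> n t = (1 / fact n) *
     (\<integral>x. indicator {x. \<forall>i<n. x i \<in> {t..1}} x *
        ((\<Prod>j<n. \<Prod>i<j. (x j - x i)\<^sup>2) * (\<Prod>k<n. x k powr \<alpha> * (1 - x k) powr \<beta>))
      \<partial>(PiM {..<n} (\<lambda>_. lborel)))"

definition Ffun :: "real \<Rightarrow> real \<Rightarrow> real" where
  "Ffun \<alpha> \<beta> = Gamma ((\<alpha> + \<beta> + 1) / 2) * (barnesG ((\<alpha> + \<beta> + 1) / 2))\<^sup>2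
      * (barnesG (1 + (\<alpha> + \<beta>) / 2))\<^sup>2
      / (barnesG (\<alpha> + \<beta> + 1) * barnesG (\<alpha> + 1) * barnesG (\<beta> + 1))"

definition Kfun :: "real \<Rightarrow> real \<Rightarrow> nat \<Rightarrow> real" where
  "Kfun \<alpha> \<beta> n = barnesG (real n + 1) * barnesG (real n + \<alpha> + 1) * barnesG (real n + \<beta> + 1)
      * barnesG (real n + \<alpha> + \<beta> + 1)
      / ((barnesG (real n + (\<alpha> + \<beta> + 1) / 2))\<^sup>2 * (barnesG (real n + 1 + (\<alpha> + \<beta>) / 2))\<^sup>2
         * Gamma (real n + (\<alpha> + \<beta> + 1) / 2))"

end

theory Submission
  imports Defs "HOL-Real_Asymp.Real_Asymp" "Jordan_Normal_Form.Determinant"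
begin

hide_const (open) Module.smult

text \<open>
  The squared Vandermonde product is a product of two determinants of monic polynomials evaluated at
  the \<open>x k\<close>, so by Andreief's identity \<^term>\<open>Dn \<alpha> \<beta> n t\<close> is the determinant of
  the matrix of weighted integrals of \<open>p i * q j\<close>, for any two families of monic polynomials.

  At \<open>t = 0\<close>, the choice \<open>p i = x ^ i\<close>, \<open>q j = (x - 1) ^ j\<close> gives Beta integrals.
  After extracting Gamma factors from rows and columns, what remains is again a matrix of monic
  polynomials at equidistant nodes; this evaluates \<^term>\<open>Dn \<alpha> \<beta> n 0\<close> as a Gamma product (Selberg).
  For \<open>\<alpha> = 0\<close>, the choice \<open>p i = q i = (x - 1) ^ i\<close> shows that \<^term>\<open>Dn 0 \<beta> n t\<close> is exactly
  \<open>(1 - t) powr (n * (n + \<beta>))\<close> times its value at \<open>t = 0\<close>. Since \<open>t powr \<alpha> \<le> x powr \<alpha> \<le> 1\<close> on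
  \<open>[t, 1]\<close>, the quotient \<^term>\<open>Dn \<alpha> \<beta> n t / Dn 0 \<beta> n t\<close> tends to 1.

  The constant \<^term>\<open>Dn 0 \<beta> n 0 / Dn \<alpha> \<beta> n 0\<close> is matched with the Barnes functions by induction on
  \<open>n\<close>, using the functional equation of \<^const>\<open>barnesG\<close> and Legendre's duplication formula.
\<close>

section \<open>The functional equation of the Barnes function\<close>

definition barnes_factor :: "real \<Rightarrow> nat \<Rightarrow> real" where
  "barnes_factor x k = (1 + x / real (Suc k)) ^ Suc k * exp (- x + x\<^sup>2 / (2 * real (Suc k)))"

lemma barnes_factor_pos: "x > -1 \<Longrightarrow> barnes_factor x k > 0"
proof -
  assume x: "x > -1"
  have "0 < real (Suc k) + x" using x by simp
  hence "0 < 1 + x / real (Suc k)" by (simp add: field_simps)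
  thus ?thesis unfolding barnes_factor_def by (intro mult_pos_pos zero_less_power) auto
qed

text \<open>The logarithm of the k-th factor is (k+1) g(x/(k+1)) with g(z) = ln(1+z) - z + z^2/2.
  Since g(z) = O(z^3) near 0, the logarithms are O(1/k^2) and hence summable.\<close>

lemma convergent_prod_barnes_factor:
  assumes "x > -1"
  shows "convergent_prod (barnes_factor x)"
\<comment> \<open>For x = 0 the sequence \<open>z\<close> below is constantly 0, which the filter
  \<open>at 0\<close> excludes.\<close>
proof (cases "x = 0")
  case True
  thus ?thesis by (simp add: barnes_factor_def[abs_def])
next
  case False
  define g where "g = (\<lambda>z::real. ln (1 + z) - z + z ^ 2 / 2)"
  define z where "z = (\<lambda>k. x / real (Suc k))"
  have "filterlim z (at 0) sequentially"
    unfolding filterlim_at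
  proof
    show "z \<longlonglongrightarrow> 0" unfolding z_def by real_asymp
    show "\<forall>\<^sub>F k in sequentially. z k \<in> UNIV \<and> z k \<noteq> 0" using False by (simp add: z_def)
  qed
  moreover have "g \<in> O[at 0](\<lambda>z. z ^ 3)" unfolding g_def by real_asymp
  ultimately have "(\<lambda>k. g (z k)) \<in> O(\<lambda>k. z k ^ 3)"
    by (rule landau_o.big.compose[rotated])
  hence "(\<lambda>k. real (Suc k) * g (z k)) \<in> O(\<lambda>k. real (Suc k) * z k ^ 3)"
    by (intro landau_o.big.mult) auto
  also have "(\<lambda>k. real (Suc k) * z k ^ 3) = (\<lambda>k. x ^ 3 * (1 / real (Suc k) ^ 2))"
    by (rule ext) (simp add: z_def power_divide power2_eq_square power3_eq_cube del: of_nat_Suc)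
  also have "\<dots> \<in> O(\<lambda>k. 1 / real (Suc k) ^ 2)"
    by (intro bigoI[of _ "norm (x ^ 3)"]) (simp add: abs_mult)
  finally have "summable (\<lambda>k. real (Suc k) * g (z k))"
  proof (rule summable_comparison_test_bigo[rotated])
    have "summable (\<lambda>k. 1 / real k ^ 2)"
      using inverse_power_summable[of 2, where 'a = real] by (simp add: field_simps)
    hence "summable (\<lambda>k. 1 / real (Suc k) ^ 2)" by (subst summable_Suc_iff)
    thus "summable (\<lambda>k. norm (1 / real (Suc k) ^ 2))" by simp
  qed
  hence "convergent_prod (\<lambda>k. exp (real (Suc k) * g (z k)))"
    by (rule convergent_prod_exp)
  also have "(\<lambda>k. exp (real (Suc k) * g (z k))) = barnes_factor x"
  proof
    fix k :: nat
    have "0 < real (Suc k) + x" using assms by simp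
    hence pos: "0 < 1 + z k" by (simp add: z_def field_simps)
    have "real (Suc k) * g (z k) = real (Suc k) * ln (1 + z k) + (- x + x\<^sup>2 / (2 * real (Suc k)))"
      by (simp add: g_def z_def divide_simps) (simp add: algebra_simps power2_eq_square)
    thus "exp (real (Suc k) * g (z k)) = barnes_factor x k"
      using pos by (simp only: exp_add[of "real (Suc k) * ln (1 + z k)"] exp_of_nat_mult exp_ln)
        (simp only: barnes_factor_def z_def)
  qed
  finally show ?thesis .
qed

lemma barnesG_conv_prodinf:
  "barnesG (x + 1) = (2 * pi) powr (x / 2) * exp (- (x * (x + 1) + euler_mascheroni * x\<^sup>2) / 2) * prodinf (barnes_factor x)"
  by (simp add: barnesG_def barnes_factor_def[abs_def])

text \<open>Convergence of an infinite product includes a nonzero limit, so positive factors give a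
  strictly positive value.\<close>

lemma prodinf_barnes_factor_pos: 
  assumes "x > -1" shows "prodinf (barnes_factor x) > 0"
  by (rule has_prod_pos[OF convergent_prod_has_prod[OF convergent_prod_barnes_factor[OF assms]]])
     (rule barnes_factor_pos[OF assms])

lemma barnesG_pos: "y > 0 \<Longrightarrow> barnesG y > 0"
  using barnesG_conv_prodinf[of "y - 1"] prodinf_barnes_factor_pos[of "y - 1"] by simp

lemma barnesG_1 [simp]: "barnesG 1 = 1"
  by (simp add: barnesG_def)

text \<open>With m = k+1, a single quotient is ((m+1+x)/(m+x))^m exp(-1 + (x+1/2)/m). The powers
  telescope and the exponents add up to a harmonic number.\<close>

lemma prod_barnes_factor_quotient:
  assumes "x > -1"
  shows "(\<Prod>k<N. barnes_factor (x + 1) k) / (\<Prod>k<N. barnes_factor x k) =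
     (real N + 1 + x) ^ N / (\<Prod>k<N. real (Suc k) + x) * exp (- real N + (x + 1 / 2) * harm N)"
proof (induction N)
  case 0
  show ?case by (simp add: harm_def)
next
  case (Suc N)
  define m where "m = real (Suc N)"
  have m: "m > 0" "m + x > 0" "m + 1 + x > 0" using assms by (auto simp: m_def)
  have f: "barnes_factor (x + 1) N / barnes_factor x N
     = ((m + 1 + x) / (m + x)) ^ Suc N * exp (- 1 + (x + 1/2) / m)"
  proof -
    have "barnes_factor (x + 1) N / barnes_factor x N = ((1 + (x + 1) / m) / (1 + x / m)) ^ Suc N *
        exp ((- (x + 1) + (x + 1)\<^sup>2 / (2 * m)) - (- x + x\<^sup>2 / (2 * m)))"
      unfolding barnes_factor_def m_def[symmetric] exp_diff power_divide times_divide_times_eq ..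
    also have "(1 + (x + 1) / m) / (1 + x / m) = (m + 1 + x) / (m + x)"
      using m by (simp add: divide_simps add_ac)
    also have "(- (x + 1) + (x + 1)\<^sup>2 / (2 * m)) - (- x + x\<^sup>2 / (2 * m)) = - 1 + (x + 1/2) / m"
      using m by (simp add: field_simps power2_eq_square)
    finally show ?thesis .
  qed
  have "(\<Prod>k<Suc N. barnes_factor (x + 1) k) / (\<Prod>k<Suc N. barnes_factor x k) = 
     ((\<Prod>k<N. barnes_factor (x + 1) k) / (\<Prod>k<N. barnes_factor x k)) *
       (barnes_factor (x + 1) N / barnes_factor x N)" by simp
  also have "\<dots> = ((m + x) ^ N / (\<Prod>k<N. real (Suc k) + x) * exp (- real N + (x + 1 / 2) * harm N)) *
       (((m + 1 + x) / (m + x)) ^ Suc N * exp (- 1 + (x + 1/2) / m))"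
    unfolding Suc f by (simp add: m_def add_ac)
  also have "\<dots> = (m + 1 + x) ^ Suc N / ((\<Prod>k<N. real (Suc k) + x) * (m + x)) *
       exp ((- real N + (x + 1 / 2) * harm N) + (- 1 + (x + 1/2) / m))"
    unfolding exp_add[of "- real N + (x + 1 / 2) * harm N"] using m by (simp add: power_divide)
  also have "(- real N + (x + 1 / 2) * harm N) + (- 1 + (x + 1/2) / m) = - real (Suc N) + (x + 1 / 2) * harm (Suc N)"
    using m by (simp add: harm_Suc m_def field_simps)
  finally show ?case by (simp add: m_def)
qed

text \<open>Regroups the telescoped quotient into three factors with known limits, involving Gamma,
  the Euler-Mascheroni constant and exp, and a last factor that depends on N alone.\<close>

lemma prod_barnes_factor_quotient_conv_Gamma_series:
  assumes "x > -1" "N > 0"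
  shows "(\<Prod>k<N. barnes_factor (x + 1) k) / (\<Prod>k<N. barnes_factor x k) =
     Gamma_series (x + 1) N * exp ((x + 1 / 2) * (harm N - ln (real N))) *
     (1 + (1 + x) / real N) powr (real N + 1) * (real N powr (real N + 1 / 2) * exp (- real N) / fact N)"
proof -
  define P where "P = (\<Prod>k<N. real (Suc k) + x)"
  define m where "m = real N + 1 + x"
  have m: "m > 0" using assms by (simp add: m_def)
  have P: "P > 0" unfolding P_def using assms by (intro prod_pos) auto
  have N: "real N > 0" using assms by simp
  have ph: "pochhammer (x + 1) (Suc N) = P * m"
    unfolding P_def m_def pochhammer_prod atLeast0LessThan by (simp add: add_ac prod.lessThan_Suc)
  have G: "Gamma_series (x + 1) N = fact N * real N powr (x + 1) / (P * m)"
    using N by (simp add: Gamma_series_def ph powr_def)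
  have E: "exp ((x + 1 / 2) * (harm N - ln (real N))) = exp ((x + 1 / 2) * harm N) * real N powr (- (x + 1/2))"
    using N by (simp add: powr_def exp_add[symmetric] algebra_simps)
  have B: "(1 + (1 + x) / real N) powr (real N + 1) = m ^ N * m * real N powr (- (real N + 1))"
  proof -
    have "1 + (1 + x) / real N = m / real N" using N by (simp add: m_def field_simps)
    hence "(1 + (1 + x) / real N) powr (real N + 1) = m powr (real N + 1) / real N powr (real N + 1)"
      using m N by (simp add: powr_divide)
    also have "m powr (real N + 1) = m ^ Suc N" using powr_realpow[OF m, of "Suc N"] by (simp add: add_ac)
    finally show ?thesis unfolding powr_minus_divide by simp
  qed
  have "real N powr (x + 1) * real N powr (- (x + 1/2)) * real N powr (- (real N + 1)) * real N powr (real N + 1 / 2) = 1"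
    using N by (simp add: powr_add[symmetric])
  hence "Gamma_series (x + 1) N * exp ((x + 1 / 2) * (harm N - ln (real N))) *
     (1 + (1 + x) / real N) powr (real N + 1) * (real N powr (real N + 1 / 2) * exp (- real N) / fact N)
    = m ^ N / P * (exp (- real N) * exp ((x + 1 / 2) * harm N))"
    unfolding G E B using m P by (simp add: field_simps)
  thus ?thesis
    unfolding prod_barnes_factor_quotient[OF assms(1), of N] P_def m_def exp_add by simp
qed


text \<open>By Stirling's formula the constant is 1. Only its independence of the argument matters, since
  \<^const>\<open>Kfun\<close> has as many factors \<^const>\<open>barnesG\<close> in the numerator as in the denominator.\<close>

lemma barnesG_shift:
  obtains c :: real where "c > 0" and "\<And>y. y > 0 \<Longrightarrow> barnesG (y + 1) = c * Gamma y * barnesG y"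
proof -
  define b where "b = (\<lambda>N::nat. real N powr (real N + 1 / 2) * exp (- real N) / fact N :: real)"
  define Q where "Q = (\<lambda>x N. (\<Prod>k<N. barnes_factor (x + 1) k) / (\<Prod>k<N. barnes_factor x k))"
  define h where "h = (\<lambda>x N. Gamma_series (x + 1) N * exp ((x + 1 / 2) * (harm N - ln (real N))) *
     (1 + (1 + x) / real N) powr (real N + 1))"
  have Q: "Q x \<longlonglongrightarrow> prodinf (barnes_factor (x + 1)) / prodinf (barnes_factor x)" if "x > -1" for x
  proof -
    have "(\<lambda>N. \<Prod>k<N. barnes_factor z k) \<longlonglongrightarrow> prodinf (barnes_factor z)" if "z > -1" for z
      using has_prod_imp_tendsto'[OF convergent_prod_has_prod[OF convergent_prod_barnes_factor[OF that]]] .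
    from this[of x] this[of "x + 1"] show ?thesis
      unfolding Q_def using that prodinf_barnes_factor_pos[OF that] by (intro tendsto_divide) auto
  qed
  have h: "h x \<longlonglongrightarrow> Gamma (x + 1) * exp ((x + 1 / 2) * euler_mascheroni) * exp (1 + x)" if "x > -1" for x
  proof -
    have "(\<lambda>N. (1 + (1 + x) / real N) powr (real N + 1)) \<longlonglongrightarrow> exp (1 + x)"
      using that by real_asymp
    thus ?thesis unfolding h_def by (intro tendsto_intros euler_mascheroni_LIMSEQ)
  qed
  have Qh: "\<forall>\<^sub>F N in sequentially. Q x N = h x N * b N" if "x > -1" for x
    using eventually_gt_at_top[of 0] 
    by eventually_elim (use prod_barnes_factor_quotient_conv_Gamma_series[OF that] in \<open>simp add: Q_def h_def b_def\<close>)
  have h_pos: "Gamma (x + 1) * exp ((x + 1 / 2) * euler_mascheroni) * exp (1 + x) > 0" if "x > -1" for x :: real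
    using that by (intro mult_pos_pos Gamma_real_pos) auto
  have b_lim: "b \<longlonglongrightarrow> prodinf (barnes_factor (x + 1)) / prodinf (barnes_factor x) /
     (Gamma (x + 1) * exp ((x + 1 / 2) * euler_mascheroni) * exp (1 + x))" if "x > -1" for x
  proof (rule Lim_transform_eventually)
    show "(\<lambda>N. Q x N / h x N) \<longlonglongrightarrow> prodinf (barnes_factor (x + 1)) / prodinf (barnes_factor x) /
     (Gamma (x + 1) * exp ((x + 1 / 2) * euler_mascheroni) * exp (1 + x))"
      using h_pos[OF that] by (intro tendsto_divide Q h that) linarith
    have "\<forall>\<^sub>F N in sequentially. h x N > 0"
      using h[OF that] h_pos[OF that] by (rule order_tendstoD)
    with Qh[OF that] show "\<forall>\<^sub>F N in sequentially. Q x N / h x N = b N"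
      by eventually_elim simp
  qed
  \<comment> \<open>\<open>b\<close> does not involve \<open>x\<close>, so by uniqueness of limits
    the quotient found in \<open>b_lim\<close> is the same number for every
    \<open>x\<close>.\<close>
  define l where "l = lim b"
  have l: "prodinf (barnes_factor (x + 1)) / prodinf (barnes_factor x) =
     l * (Gamma (x + 1) * exp ((x + 1 / 2) * euler_mascheroni) * exp (1 + x))" if "x > -1" for x
    unfolding l_def limI[OF b_lim[OF that]] using h_pos[OF that] by (intro iffD1[OF nonzero_eq_divide_eq, symmetric, OF _ refl]) linarith
  \<comment> \<open>Read off at x = 0, where the quotient of the two infinite products is positive;
    positivity of the terms of \<open>b\<close> would not exclude the limit 0.\<close>
  have "l > 0"
  proof -
    have "0 < prodinf (barnes_factor (0 + 1)) / prodinf (barnes_factor 0)"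
      by (intro divide_pos_pos prodinf_barnes_factor_pos) auto
    thus ?thesis by (subst (asm) l) (auto simp: zero_less_mult_iff mult_less_0_iff)
  qed
  show thesis
  \<comment> \<open>The root comes from the prefactor (2 pi)^(x/2), whose exponent grows by 1/2. The
    exponential prefactors cancel against the exponentials in the limit of \<open>h\<close>.\<close>
  proof (rule that[of "sqrt (2 * pi) * l"])
    show "sqrt (2 * pi) * l > 0" using \<open>l > 0\<close> by simp
    fix y :: real assume y: "y > 0"
    define x where "x = y - 1"
    have x: "x > -1" "y = x + 1" using y by (simp_all add: x_def)
    have p: "prodinf (barnes_factor (x + 1)) = 
       l * (Gamma (x + 1) * exp ((x + 1 / 2) * euler_mascheroni) * exp (1 + x)) * prodinf (barnes_factor x)"
      using l[OF x(1)] prodinf_barnes_factor_pos[OF x(1)] by (simp add: field_simps)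
    have e: "exp (- ((x + 1) * (x + 1 + 1) + euler_mascheroni * (x + 1)\<^sup>2) / 2) *
        (exp ((x + 1 / 2) * euler_mascheroni) * exp (1 + x)) =
       exp (- (x * (x + 1) + euler_mascheroni * x\<^sup>2) / 2 :: real)"
      unfolding exp_add[symmetric] by (rule arg_cong[of _ _ exp]) (simp add: field_simps power2_eq_square)
    have q: "(2 * pi) powr ((x + 1) / 2) = sqrt (2 * pi) * (2 * pi) powr (x / 2)"
      by (simp add: add_divide_distrib powr_add powr_half_sqrt)
    have "barnesG (y + 1) = (2 * pi) powr ((x + 1) / 2) *
       (exp (- ((x + 1) * (x + 1 + 1) + euler_mascheroni * (x + 1)\<^sup>2) / 2) *
        (exp ((x + 1 / 2) * euler_mascheroni) * exp (1 + x))) * (l * Gamma (x + 1)) * prodinf (barnes_factor x)"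
      unfolding x(2) barnesG_conv_prodinf[of "x + 1"] p by (simp only: mult_ac)
    also have "\<dots> = sqrt (2 * pi) * l * Gamma (x + 1) * barnesG (x + 1)"
      unfolding e q barnesG_conv_prodinf[of x] by (simp only: mult_ac)
    finally show "barnesG (y + 1) = sqrt (2 * pi) * l * Gamma y * barnesG y" by (simp add: x(2))
  qed
qed

section \<open>Determinants of monic polynomials and Andreief's identity\<close>

text \<open>The Newton basis of the nodes \<open>x\<close>: the k-th member is monic of degree k and
  vanishes at the nodes of index below k, so its values at the nodes form a triangular
  matrix.\<close>

definition newton_poly :: "(nat \<Rightarrow> 'a :: comm_ring_1) \<Rightarrow> nat \<Rightarrow> 'a poly" where
  "newton_poly x k = (\<Prod>m<k. [:- x m, 1:])"

lemma poly_newton_poly: "poly (newton_poly x k) y = (\<Prod>m<k. y - x m)"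
  by (simp add: newton_poly_def poly_prod)

lemma coeff_newton_poly_self: "coeff (newton_poly x k) k = 1"
  and coeff_newton_poly_gt: "i > k \<Longrightarrow> coeff (newton_poly x k) i = 0"
proof (induction k arbitrary: i)
  case 0
  case 1 show ?case by (simp add: newton_poly_def)
  case 2 thus ?case by (simp add: newton_poly_def)
next
  case (Suc k)
  have *: "newton_poly x (Suc k) = pCons 0 (newton_poly x k) - smult (x k) (newton_poly x k)"
    by (simp add: newton_poly_def mult.commute)
  case 1 show ?case using Suc by (simp add: *)
  case 2 thus ?case using Suc(2)[of i] Suc(2)[of "i - 1"] by (cases i) (simp_all add: *)
qed

text \<open>Subtracting the right multiple of \<open>newton_poly x m\<close> removes the coefficient
  at m. The basis is monic, so no division occurs and any commutative ring will do.\<close>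

lemma newton_expansion:
  assumes "\<And>i. i \<ge> m \<Longrightarrow> coeff p i = 0"
  shows "\<exists>c. p = (\<Sum>k<m. smult (c k) (newton_poly x k))"
  using assms
proof (induction m arbitrary: p)
  case 0
  thus ?case by (auto intro: poly_eqI)
next
  case (Suc m)
  define q where "q = p - smult (coeff p m) (newton_poly x m)"
  have "coeff q i = 0" if "i \<ge> m" for i
    using that Suc.prems[of i] 
    by (cases "i = m") (simp_all add: q_def coeff_newton_poly_self coeff_newton_poly_gt)
  then obtain c where c: "q = (\<Sum>k<m. smult (c k) (newton_poly x k))"
    using Suc.IH by blast
  have "p = (\<Sum>k<Suc m. smult ((c(m := coeff p m)) k) (newton_poly x k))"
    using c by (simp add: q_def algebra_simps)
  thus ?case by blast
qed

text \<open>The coefficients are padded with zeros so that polynomials of different degrees share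
  one range of summation, as a matrix product requires.\<close>

lemma newton_expansion_monic:
  assumes "degree p \<le> j" "coeff p j = 1"
  obtains c where "c j = 1" "\<And>k. k > j \<Longrightarrow> c k = 0" 
    "\<And>n. j < n \<Longrightarrow> p = (\<Sum>k<n. smult (c k) (newton_poly x k))"
proof -
  have "coeff (p - newton_poly x j) i = 0" if "i \<ge> j" for i
    using that assms by (cases "i = j") (auto simp: coeff_newton_poly_self coeff_newton_poly_gt coeff_eq_0)
  then obtain c where c: "p - newton_poly x j = (\<Sum>k<j. smult (c k) (newton_poly x k))"
    using newton_expansion by blast
  define d where "d = (\<lambda>k. if k < j then c k else if k = j then 1 else 0)"
  show thesis
  proof (rule that[of d])
    fix n assume n: "j < n"
    have "(\<Sum>k<n. smult (d k) (newton_poly x k)) = (\<Sum>k<Suc j. smult (d k) (newton_poly x k))"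
      using n by (intro sum.mono_neutral_right) (auto simp: d_def)
    also have "\<dots> = p" using c by (simp add: d_def algebra_simps)
    finally show "p = (\<Sum>k<n. smult (d k) (newton_poly x k))" ..
  qed (auto simp: d_def)
qed

text \<open>Expanding the polynomials in the Newton basis of the nodes factors the matrix into a lower triangular
  and an upper unitriangular one.\<close>

theorem det_monic_polys:
  fixes x :: "nat \<Rightarrow> 'a :: comm_ring_1"
  assumes "\<And>j. j < n \<Longrightarrow> degree (p j) \<le> j" "\<And>j. j < n \<Longrightarrow> coeff (p j) j = 1"
  shows "det (mat n n (\<lambda>(i, j). poly (p j) (x i))) = (\<Prod>j<n. \<Prod>i<j. x j - x i)"
proof -
  have "\<exists>c. c j = 1 \<and> (\<forall>k>j. c k = 0) \<and> p j = (\<Sum>k<n. smult (c k) (newton_poly x k))"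
    if "j < n" for j
    using newton_expansion_monic[of "p j" j x] assms[OF that] that by metis
  then obtain c where c: "\<And>j. j < n \<Longrightarrow> c j j = 1" "\<And>j k. j < n \<Longrightarrow> k > j \<Longrightarrow> c j k = 0"
      "\<And>j. j < n \<Longrightarrow> p j = (\<Sum>k<n. smult (c j k) (newton_poly x k))" by metis
  define L where "L = mat n n (\<lambda>(i, k). poly (newton_poly x k) (x i))"
  define U where "U = mat n n (\<lambda>(k, j). c j k)"
  have dims: "L \<in> carrier_mat n n" "U \<in> carrier_mat n n" by (simp_all add: L_def U_def)
  have "mat n n (\<lambda>(i, j). poly (p j) (x i)) = L * U"
    by (rule eq_matI)
       (simp_all add: L_def U_def scalar_prod_def c(3) poly_sum mult.commute atLeast0LessThan)
  moreover have "det L = (\<Prod>j<n. \<Prod>i<j. x j - x i)"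
  proof -
    have "det L = prod_list (diag_mat L)"
      by (rule det_lower_triangular[OF _ dims(1)]) (auto simp: L_def poly_newton_poly intro!: prod_zero)
    thus ?thesis by (simp add: prod_list_diag_prod L_def poly_newton_poly atLeast0LessThan)
  qed
  moreover have "det U = 1"
  proof -
    have "det U = prod_list (diag_mat U)"
      by (rule det_upper_triangular[OF _ dims(2)]) (auto simp: U_def c(2) upper_triangular_def)
    thus ?thesis by (simp add: prod_list_diag_prod U_def c(1))
  qed
  ultimately show ?thesis by (simp add: det_mult[OF dims])
qed

section \<open>Determinants under scaling and reversal of rows and columns\<close>

lemma det_scale_rows_cols:
  fixes A :: "nat \<Rightarrow> nat \<Rightarrow> 'a :: comm_ring_1"
  shows "det (mat n n (\<lambda>(i, j). r i * s j * A i j)) = (\<Prod>i<n. r i) * (\<Prod>j<n. s j) * det (mat n n (\<lambda>(i, j). A i j))"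
proof -
  have "(\<Prod>i=0..<n. mat n n (\<lambda>(i, j). r i * s j * A i j) $$ (i, p i))
     = (\<Prod>i<n. r i) * (\<Prod>j<n. s j) * (\<Prod>i=0..<n. mat n n (\<lambda>(i, j). A i j) $$ (i, p i))"
    if p: "p permutes {0..<n}" for p
  proof -
    have "(\<Prod>i=0..<n. mat n n (\<lambda>(i, j). r i * s j * A i j) $$ (i, p i)) = (\<Prod>i=0..<n. r i * s (p i) * A i (p i))"
      by (rule prod.cong) (use permutes_in_image[OF p] in auto)
    also have "\<dots> = (\<Prod>i=0..<n. r i) * (\<Prod>i=0..<n. s (p i)) * (\<Prod>i=0..<n. A i (p i))"
      by (simp add: prod.distrib)
    also have "(\<Prod>i=0..<n. s (p i)) = (\<Prod>j=0..<n. s j)"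
      using prod.permute[OF p, of s] by (simp add: o_def)
    also have "(\<Prod>i=0..<n. A i (p i)) = (\<Prod>i=0..<n. mat n n (\<lambda>(i, j). A i j) $$ (i, p i))"
      by (rule prod.cong) (use permutes_in_image[OF p] in auto)
    finally show ?thesis by (simp add: atLeast0LessThan)
  qed
  thus ?thesis by (simp add: det_def sum_distrib_left mult_ac)
qed

text \<open>Rows and columns undergo the same permutation, so its sign enters twice and cancels.
  Columns are reduced to rows by transposition.\<close>

lemma det_reverse:
  fixes A :: "nat \<Rightarrow> nat \<Rightarrow> 'a :: comm_ring_1"
  shows "det (mat n n (\<lambda>(i, j). A (n - 1 - i) (n - 1 - j))) = det (mat n n (\<lambda>(i, j). A i j))"
proof -
  define p where "p = (\<lambda>i. if i < n then n - 1 - i else i)"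
  have p: "p permutes {0..<n}"
  proof (rule bij_imp_permutes)
    show "bij_betw p {0..<n} {0..<n}"
      by (rule bij_betwI[of _ _ _ p]) (auto simp: p_def)
  qed (auto simp: p_def)
  have [simp]: "p i < n \<longleftrightarrow> i < n" for i by (auto simp: p_def)
  have swap: "det (mat n n (\<lambda>(i, j). B (p i) j)) = signof p * det (mat n n (\<lambda>(i, j). B i j))"
    for B :: "nat \<Rightarrow> nat \<Rightarrow> 'a"
  proof -
    have "mat n n (\<lambda>(i, j). B (p i) j) = mat n n (\<lambda>(i, j). mat n n (\<lambda>(i, j). B i j) $$ (p i, j))"
      by (rule eq_matI) auto
    thus ?thesis using det_permute_rows[OF _ p, of "mat n n (\<lambda>(i, j). B i j)"] by simp
  qed
  have tr: "det (mat n n (\<lambda>(i, j). B j i)) = det (mat n n (\<lambda>(i, j). B i j))" for B :: "nat \<Rightarrow> nat \<Rightarrow> 'a"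
  proof -
    have "mat n n (\<lambda>(i, j). B j i) = transpose_mat (mat n n (\<lambda>(i, j). B i j))"
      by (rule eq_matI) auto
    thus ?thesis using det_transpose[of "mat n n (\<lambda>(i, j). B i j)" n] by simp
  qed
  have "mat n n (\<lambda>(i, j). A (n - 1 - i) (n - 1 - j)) = mat n n (\<lambda>(i, j). A (p i) (p j))"
    by (rule eq_matI) (auto simp: p_def)
  also have "det \<dots> = signof p * det (mat n n (\<lambda>(i, j). A i (p j)))"
    by (rule swap)
  also have "det (mat n n (\<lambda>(i, j). A i (p j))) = signof p * det (mat n n (\<lambda>(i, j). A i j))"
    by (subst (1 2) tr[symmetric]) (rule swap)
  finally show ?thesis by (simp add: sign_def)
qed

text \<open>After the Leibniz expansion of both determinants every term is a product over the
  coordinates, so Fubini turns it into a product of one-dimensional integrals. For each fixed p the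
  sum over q is the same determinant, which gives the factor n!.\<close>

theorem (in sigma_finite_measure) andreief:
  fixes f g :: "nat \<Rightarrow> 'a \<Rightarrow> real" and w :: "'a \<Rightarrow> real"
  assumes int: "\<And>i j. i < n \<Longrightarrow> j < n \<Longrightarrow> integrable M (\<lambda>x. f i x * g j x * w x)"
  defines "F \<equiv> \<lambda>x. det (mat n n (\<lambda>(k, i). f i (x k))) * det (mat n n (\<lambda>(k, j). g j (x k))) * (\<Prod>k<n. w (x k))"
  shows "integrable (PiM {..<n} (\<lambda>_. M)) F"
    and "(\<integral>x. F x \<partial>PiM {..<n} (\<lambda>_. M)) = fact n * det (mat n n (\<lambda>(i, j). \<integral>x. f i x * g j x * w x \<partial>M))"
proof -
  interpret P: product_sigma_finite "\<lambda>_::nat. M" ..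
  define S where "S = {p. p permutes {0..<n}}"
  have finS: "finite S" unfolding S_def by (rule finite_permutations) simp
  have S: "p k < n" if "p \<in> S" "k < n" for p k
    using that permutes_in_image[of p "{0..<n}" k] by (simp add: S_def)
  define m where "m = (\<lambda>i j. \<integral>x. f i x * g j x * w x \<partial>M)"
  define t where "t = (\<lambda>p q x. \<Prod>k<n. f (p k) (x k) * g (q k) (x k) * w (x k))"
  have det_eq: "det (mat n n (\<lambda>(k, i). h k i)) = (\<Sum>p\<in>S. signof p * (\<Prod>k<n. h k (p k)))" for h :: "nat \<Rightarrow> nat \<Rightarrow> real"
  proof -
    have "det (mat n n (\<lambda>(k, i). h k i)) =
        (\<Sum>p\<in>S. signof p * (\<Prod>k=0..<n. mat n n (\<lambda>(k, i). h k i) $$ (k, p k)))"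
      by (simp add: det_def S_def)
    thus ?thesis by (simp add: S atLeast0LessThan)
  qed
  have F_eq: "F = (\<lambda>x. \<Sum>p\<in>S. \<Sum>q\<in>S. signof p * signof q * t p q x)"
    unfolding F_def det_eq t_def sum_distrib_right[of _ S] prod.distrib
    by (simp only: sum_distrib_left mult_ac)
  have t_int: "integrable (PiM {..<n} (\<lambda>_. M)) (t p q)" if "p \<in> S" "q \<in> S" for p q
    unfolding t_def using that by (intro P.product_integrable_prod int) (auto simp: S)
  have t_eq: "(\<integral>x. t p q x \<partial>PiM {..<n} (\<lambda>_. M)) = (\<Prod>k<n. m (p k) (q k))" if "p \<in> S" "q \<in> S" for p q
    unfolding t_def m_def using that by (intro P.product_integral_prod int) (auto simp: S)
  show "integrable (PiM {..<n} (\<lambda>_. M)) F"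
    unfolding F_eq by (intro Bochner_Integration.integrable_sum integrable_mult_right t_int)
  have "(\<integral>x. F x \<partial>PiM {..<n} (\<lambda>_. M)) = (\<Sum>p\<in>S. \<Sum>q\<in>S. signof p * signof q * (\<Prod>k<n. m (p k) (q k)))"
    unfolding F_eq by (simp add: Bochner_Integration.integral_sum t_int t_eq)
  also have "\<dots> = (\<Sum>p\<in>S. det (mat n n (\<lambda>(i, j). m i j)))"
  proof (rule sum.cong)
    fix p assume p: "p \<in> S"
    hence pp: "p permutes {0..<n}" by (simp add: S_def)
    \<comment> \<open>Reindexing q as q o p produces the sign of p a second time, and p then only
      reorders the factors over k.\<close>
    have "(\<Sum>q\<in>S. signof p * signof q * (\<Prod>k<n. m (p k) (q k))) =
          (\<Sum>q\<in>S. signof p * signof (q \<circ> p) * (\<Prod>k<n. m (p k) (q (p k))))"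
      unfolding S_def by (subst sum_permutations_compose_right[OF pp]) simp
    also have "\<dots> = (\<Sum>q\<in>S. signof q * (\<Prod>k<n. m k (q k)))"
    proof (rule sum.cong)
      fix q assume "q \<in> S"
      hence "sign (q \<circ> p) = sign q * sign p"
        using pp by (intro sign_compose) (auto simp: S_def permutation_permutes)
      moreover have "(\<Prod>k<n. m (p k) (q (p k))) = (\<Prod>k<n. m k (q k))"
        using prod.permute[OF pp, of "\<lambda>k. m k (q k)"] by (simp add: o_def atLeast0LessThan)
      ultimately show "signof p * signof (q \<circ> p) * (\<Prod>k<n. m (p k) (q (p k))) = signof q * (\<Prod>k<n. m k (q k))"
        by (simp add: sign_def)
    qed simp
    finally show "(\<Sum>q\<in>S. signof p * signof q * (\<Prod>k<n. m (p k) (q k))) = det (mat n n (\<lambda>(i, j). m i j))"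
      by (simp add: det_eq)
  qed simp
  also have "\<dots> = fact n * det (mat n n (\<lambda>(i, j). m i j))"
    using card_permutations[of "{0..<n}" n] by (simp add: S_def)
  finally show "(\<integral>x. F x \<partial>PiM {..<n} (\<lambda>_. M)) = fact n * det (mat n n (\<lambda>(i, j). \<integral>x. f i x * g j x * w x \<partial>M))"
    unfolding m_def .
qed

section \<open>The Selberg product and the Barnes functions\<close>

text \<open>Legendre's duplication formula, carried over from the complex numbers and solved for
  \<open>Gamma (2 * z)\<close>.\<close>

lemma Gamma_double_real:
  fixes z :: real
  assumes "z > 0"
  shows "Gamma (2 * z) = 2 powr (2 * z - 1) / sqrt pi * Gamma z * Gamma (z + 1 / 2)"
proof -
  have "complex_of_real z \<notin> \<int>\<^sub>\<le>\<^sub>0" "complex_of_real z + 1 / 2 \<notin> \<int>\<^sub>\<le>\<^sub>0"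
    using assms by (auto elim!: nonpos_Ints_cases simp: complex_eq_iff)
  from Gamma_legendre_duplication[OF this]
  have "complex_of_real (Gamma z * Gamma (z + 1 / 2)) =
      complex_of_real (exp ((1 - 2 * z) * ln 2) * sqrt pi * Gamma (2 * z))"
    unfolding of_real_mult Gamma_complex_of_real[symmetric] exp_of_real[symmetric] by simp
  hence "Gamma z * Gamma (z + 1 / 2) = 2 powr (1 - 2 * z) * sqrt pi * Gamma (2 * z)"
    unfolding of_real_eq_iff powr_def by simp
  hence "2 powr (2 * z - 1) / sqrt pi * (Gamma z * Gamma (z + 1 / 2)) =
      (2 powr (2 * z - 1) * 2 powr (1 - 2 * z)) * Gamma (2 * z)"
    by simp
  also have "2 powr (2 * z - 1) * 2 powr (1 - 2 * z) = (1 :: real)"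
    by (simp add: powr_add[symmetric])
  finally show ?thesis by (simp add: mult.assoc)
qed

text \<open>Selberg's product for the squared Vandermonde, divided by n!; the division turns the
  product of the (j+1)! into that of the j!.\<close>

definition selberg_prod :: "real \<Rightarrow> real \<Rightarrow> nat \<Rightarrow> real" where
  "selberg_prod \<alpha> \<beta> n = (\<Prod>j<n. fact j * Gamma (\<alpha> + 1 + real j) * Gamma (\<beta> + 1 + real j) /
     Gamma (\<alpha> + \<beta> + 1 + real n + real j))"

lemma selberg_prod_pos: "\<alpha> \<ge> 0 \<Longrightarrow> \<beta> \<ge> 0 \<Longrightarrow> selberg_prod \<alpha> \<beta> n > 0"
  unfolding selberg_prod_def by (intro prod_pos mult_pos_pos divide_pos_pos Gamma_real_pos) auto

text \<open>The denominators depend on n as well as on j. Multiplying the denominator for n+1 by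
  Gamma(s+n) closes the gap at the lower end, so that it extends the denominator for n by two
  factors at the upper end.\<close>

lemma selberg_prod_Suc:
  assumes "\<alpha> \<ge> 0" "\<beta> \<ge> 0"
  defines "s \<equiv> \<alpha> + \<beta> + 1"
  shows "selberg_prod \<alpha> \<beta> (Suc n) = selberg_prod \<alpha> \<beta> n *
    (fact n * Gamma (\<alpha> + 1 + real n) * Gamma (\<beta> + 1 + real n) * Gamma (s + real n) /
      (Gamma (s + 2 * real n) * Gamma (s + 2 * real n + 1)))"
proof -
  define T where "T = (\<lambda>n. \<Prod>j<n. Gamma (s + real n + real j))"
  define P where "P = (\<lambda>n. \<Prod>j<n. fact j * Gamma (\<alpha> + 1 + real j) * Gamma (\<beta> + 1 + real j))"
  have G: "Gamma (s + x) > 0" if "x \<ge> 0" for x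
    using assms that by (intro Gamma_real_pos) (simp add: s_def)
  have T_pos: "T k > 0" for k
    unfolding T_def by (intro prod_pos) (auto simp: add.assoc intro!: G)
  have eq: "selberg_prod \<alpha> \<beta> k = P k / T k" for k
    by (simp add: selberg_prod_def P_def T_def s_def prod_dividef)
  have "Gamma (s + real n) * T (Suc n) = (\<Prod>j<Suc (Suc n). Gamma (s + real n + real j))"
    unfolding T_def by (subst (2) prod.lessThan_Suc_shift) (simp add: algebra_simps)
  also have "\<dots> = T n * (Gamma (s + 2 * real n) * Gamma (s + 2 * real n + 1))"
    by (simp add: T_def algebra_simps)
  finally have "Gamma (s + real n) * T (Suc n) = T n * (Gamma (s + 2 * real n) * Gamma (s + 2 * real n + 1))" .
  moreover have "Gamma (s + 2 * real n) > 0" "Gamma (s + 2 * real n + 1) > 0" "Gamma (s + real n) > 0"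
    using G[of "2 * real n"] G[of "2 * real n + 1"] G[of "real n"] by (simp_all add: add.assoc)
  ultimately have "1 / T (Suc n) = Gamma (s + real n) / (T n * (Gamma (s + 2 * real n) * Gamma (s + 2 * real n + 1)))"
    using T_pos[of n] T_pos[of "Suc n"] by (simp add: divide_simps mult.commute)
  hence "P (Suc n) / T (Suc n) = P (Suc n) * (Gamma (s + real n) / (T n * (Gamma (s + 2 * real n) * Gamma (s + 2 * real n + 1))))"
    by (metis mult.right_neutral times_divide_eq_right)
  thus ?thesis unfolding eq by (simp add: P_def)
qed

lemma Kfun_Suc:
  assumes "\<alpha> \<ge> 0" "\<beta> \<ge> 0"
  defines "s \<equiv> \<alpha> + \<beta> + 1"
  shows "Kfun \<alpha> \<beta> (Suc n) = Kfun \<alpha> \<beta> n *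
    (fact n * Gamma (\<alpha> + 1 + real n) * Gamma (\<beta> + 1 + real n) * Gamma (s + real n) /
     ((Gamma (real n + s / 2))\<^sup>2 * (Gamma (real n + s / 2 + 1 / 2))\<^sup>2 * (real n + s / 2)))"
proof -
  obtain c where c: "c > 0" "\<And>y. y > 0 \<Longrightarrow> barnesG (y + 1) = c * Gamma y * barnesG y"
    using barnesG_shift by blast
  have args: "real (Suc n) + 1 = (real n + 1) + 1" "real (Suc n) + \<alpha> + 1 = (real n + \<alpha> + 1) + 1"
    "real (Suc n) + \<beta> + 1 = (real n + \<beta> + 1) + 1" "real (Suc n) + \<alpha> + \<beta> + 1 = (real n + \<alpha> + \<beta> + 1) + 1"
    "real (Suc n) + (\<alpha> + \<beta> + 1) / 2 = (real n + s / 2) + 1"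
    "real (Suc n) + 1 + (\<alpha> + \<beta>) / 2 = (real n + s / 2 + 1 / 2) + 1"
    "real n + (\<alpha> + \<beta> + 1) / 2 = real n + s / 2"
    "real n + 1 + (\<alpha> + \<beta>) / 2 = real n + s / 2 + 1 / 2"
    "\<alpha> + 1 + real n = real n + \<alpha> + 1" "\<beta> + 1 + real n = real n + \<beta> + 1" "s + real n = real n + \<alpha> + \<beta> + 1"
    by (simp_all add: s_def field_simps)
  have "s \<ge> 1" using assms by simp
  hence pos: "real n + 1 > 0" "real n + \<alpha> + 1 > 0" "real n + \<beta> + 1 > 0" "real n + \<alpha> + \<beta> + 1 > 0"
    "real n + s / 2 > 0" "real n + s / 2 + 1 / 2 > 0" using assms(1,2) by linarith+
  have G: "Gamma (real n + s / 2 + 1) = (real n + s / 2) * Gamma (real n + s / 2)"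
    using pos(5) by (intro Gamma_plus1) (auto dest!: nonpos_Ints_nonpos)
  have F: "Gamma (real n + 1) = fact n" by (simp add: Gamma_fact add.commute)
  \<comment> \<open>The fourth power of c occurs above and below. The factor z is the one gained by
    the single Gamma in the denominator of \<open>Kfun\<close>.\<close>
  have alg: "(c * f * g1) * (c * a * g2) * (c * b * g3) * (c * d * g4) / ((c * u * g5)\<^sup>2 * (c * v * g6)\<^sup>2 * (z * u)) =
      g1 * g2 * g3 * g4 / (g5\<^sup>2 * g6\<^sup>2 * u) * (f * a * b * d / (u\<^sup>2 * v\<^sup>2 * z))"
    if "c \<noteq> 0" "u \<noteq> 0" "z \<noteq> 0" for c f a b d u v z g1 g2 g3 g4 g5 g6 :: real
    using that by (simp add: divide_simps) (simp add: power2_eq_square power4_eq_xxxx mult.assoc)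
  show ?thesis
    unfolding Kfun_def args(6,8) unfolding args G pos[THEN c(2)] F
    by (rule alg) (use c(1) pos(5) Gamma_real_pos[OF pos(5)] in linarith)+
qed

text \<open>At n = 0 the two functions are reciprocal. In the step from n to n+1 the duplication
  formula turns the Gamma values at half arguments into those of \<open>selberg_prod_Suc\<close>,
  leaving powers of 2 and pi. The last product is free of \<alpha> and \<beta>, so it cancels in
  quotients.\<close>

lemma Ffun_Kfun:
  assumes "\<alpha> \<ge> 0" "\<beta> \<ge> 0"
  shows "Ffun \<alpha> \<beta> * Kfun \<alpha> \<beta> n =
    selberg_prod \<alpha> \<beta> n * 2 powr (2 * real n * (\<alpha> + \<beta> + 1)) * (\<Prod>j<n. 2 ^ (4 * j) / (2 * pi))"
proof (induction n)
  case 0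
  have pos: "(\<alpha> + \<beta> + 1) / 2 > 0" "1 + (\<alpha> + \<beta>) / 2 > 0" "\<alpha> + \<beta> + 1 > 0" "\<alpha> + 1 > 0" "\<beta> + 1 > 0"
    using assms by (auto intro!: add_pos_nonneg)
  show ?case
    unfolding Ffun_def Kfun_def selberg_prod_def
    using pos[THEN barnesG_pos] pos(1)[THEN Gamma_real_pos] by (simp add: add.assoc)
next
  case (Suc n)
  define s where "s = \<alpha> + \<beta> + 1"
  define z where "z = real n + s / 2"
  have z: "z > 0" using assms by (auto simp: z_def s_def intro!: add_nonneg_pos)
  have sz: "s + 2 * real n = 2 * z" by (simp add: z_def)
  define X where "X = fact n * Gamma (\<alpha> + 1 + real n) * Gamma (\<beta> + 1 + real n) * Gamma (s + real n)"
  have pos: "Gamma z > 0" "Gamma (z + 1 / 2) > 0" "Gamma (2 * z) > 0" using z by (auto intro!: Gamma_real_pos)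
  have G: "Gamma (2 * z + 1) = 2 * z * Gamma (2 * z)"
    using z by (intro Gamma_plus1) (auto dest!: nonpos_Ints_nonpos)
  have p: "(2 powr (2 * z - 1))\<^sup>2 * 2 = 2 powr (2 * s) * (2 ^ (4 * n) / (2 :: real))"
  proof -
    have "(2 powr (2 * z - 1))\<^sup>2 * 2 = 2 powr ((2 * z - 1) + (2 * z - 1) + 1)"
      unfolding powr_add power2_eq_square by simp
    also have "(2 * z - 1) + (2 * z - 1) + 1 = 2 * s + (real (4 * n) - 1)" by (simp add: z_def)
    also have "2 powr \<dots> = 2 powr (2 * s) * (2 powr real (4 * n) / (2 :: real))"
      by (simp add: powr_add powr_diff)
    finally show ?thesis by (subst (asm) powr_realpow) auto
  qed
  have "X / ((Gamma z)\<^sup>2 * (Gamma (z + 1 / 2))\<^sup>2 * z) =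
        X / (Gamma (2 * z) * Gamma (2 * z + 1)) * ((2 powr (2 * z - 1))\<^sup>2 * 2 / pi)"
    unfolding G Gamma_double_real[OF z] using pos z
    by (simp add: divide_simps) (simp add: power2_eq_square)
  also have "(2 powr (2 * z - 1))\<^sup>2 * 2 / pi = 2 powr (2 * s) * (2 ^ (4 * n) / (2 * pi))"
    unfolding p by simp
  finally have step: "X / ((Gamma z)\<^sup>2 * (Gamma (z + 1 / 2))\<^sup>2 * z) =
        X / (Gamma (2 * z) * Gamma (2 * z + 1)) * (2 powr (2 * s) * (2 ^ (4 * n) / (2 * pi)))" .
  have K: "Kfun \<alpha> \<beta> (Suc n) = Kfun \<alpha> \<beta> n * (X / ((Gamma z)\<^sup>2 * (Gamma (z + 1 / 2))\<^sup>2 * z))"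
    using Kfun_Suc[OF assms, of n] by (simp add: X_def z_def s_def)
  have S: "selberg_prod \<alpha> \<beta> (Suc n) = selberg_prod \<alpha> \<beta> n * (X / (Gamma (2 * z) * Gamma (2 * z + 1)))"
    using selberg_prod_Suc[OF assms, of n] unfolding s_def[symmetric] sz X_def .
  have pw: "2 powr (2 * real (Suc n) * s) = 2 powr (2 * real n * s) * (2 powr (2 * s) :: real)"
    by (simp add: powr_add[symmetric] algebra_simps)
  have "Ffun \<alpha> \<beta> * Kfun \<alpha> \<beta> (Suc n) = (Ffun \<alpha> \<beta> * Kfun \<alpha> \<beta> n) *
     (X / (Gamma (2 * z) * Gamma (2 * z + 1)) * (2 powr (2 * s) * (2 ^ (4 * n) / (2 * pi))))"
    unfolding K step by (simp only: mult.assoc)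
  also have "\<dots> = selberg_prod \<alpha> \<beta> (Suc n) * 2 powr (2 * real (Suc n) * s) * (\<Prod>j<Suc n. 2 ^ (4 * j) / (2 * pi))"
    unfolding Suc s_def[symmetric] S pw prod.lessThan_Suc by (simp only: mult_ac)
  finally show ?case unfolding s_def .
qed

section \<open>Evaluation of the Jacobi integral\<close>

text \<open>The truncation to [t, 1] is part of the weight, so that the multiple integral runs over
  the whole product space with a product weight, as in Andreief's identity.\<close>

definition jacobi_weight :: "real \<Rightarrow> real \<Rightarrow> real \<Rightarrow> real \<Rightarrow> real" where
  "jacobi_weight \<alpha> \<beta> t x = indicator {t..1} x * (x powr \<alpha> * (1 - x) powr \<beta>)"

lemma jacobi_weight_nonneg: "jacobi_weight \<alpha> \<beta> t x \<ge> 0"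
  by (simp add: jacobi_weight_def)

text \<open>For nonnegative exponents the weight is at most 1 on [0, 1], so the indicator of that
  interval dominates.\<close>

lemma integrable_jacobi_weight:
  assumes [measurable]: "f \<in> borel_measurable borel" and f: "\<And>x. x \<in> {0..1} \<Longrightarrow> \<bar>f x\<bar> \<le> 1"
    and "\<alpha> \<ge> 0" "\<beta> \<ge> 0" "t \<ge> 0"
  shows "integrable lborel (\<lambda>x. f x * jacobi_weight \<alpha> \<beta> t x)"
proof (rule Bochner_Integration.integrable_bound)
  show "integrable lborel (indicator {0..1} :: real \<Rightarrow> real)" by simp
  show "(\<lambda>x. f x * jacobi_weight \<alpha> \<beta> t x) \<in> borel_measurable lborel"
    unfolding jacobi_weight_def by measurable
  show "AE x in lborel. norm (f x * jacobi_weight \<alpha> \<beta> t x) \<le> norm (indicator {0..1} x :: real)"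
  proof (rule AE_I2)
    fix x :: real
    show "norm (f x * jacobi_weight \<alpha> \<beta> t x) \<le> norm (indicator {0..1} x :: real)"
    proof (cases "x \<in> {t..1}")
      case True
      hence x: "x \<in> {0..1}" using assms by auto
      hence "x powr \<alpha> * (1 - x) powr \<beta> \<le> 1 * 1" using assms by (intro mult_mono powr_le1) auto
      hence "\<bar>f x\<bar> * (x powr \<alpha> * (1 - x) powr \<beta>) \<le> 1 * 1" using f[OF x] by (intro mult_mono) auto
      thus ?thesis using True x by (simp add: jacobi_weight_def abs_mult)
    qed (simp add: jacobi_weight_def)
  qed
qed

text \<open>Beta integrals and antiderivatives yield \<open>has_integral\<close> facts, while the
  determinant entries are Lebesgue integrals; this links the two.\<close>

lemma integral_jacobi_weight:
  assumes "integrable lborel (\<lambda>x. f x * jacobi_weight \<alpha> \<beta> t x)"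
    and "((\<lambda>x. f x * (x powr \<alpha> * (1 - x) powr \<beta>)) has_integral I) {t..1}"
  shows "(\<integral>x. f x * jacobi_weight \<alpha> \<beta> t x \<partial>lborel) = I"
proof -
  have eq: "(\<lambda>x. f x * jacobi_weight \<alpha> \<beta> t x) = (\<lambda>x. indicator {t..1} x *\<^sub>R (f x * (x powr \<alpha> * (1 - x) powr \<beta>)))"
    by (auto simp: jacobi_weight_def)
  have "set_integrable lborel {t..1} (\<lambda>x. f x * (x powr \<alpha> * (1 - x) powr \<beta>))"
    using assms(1) unfolding set_integrable_def eq .
  from set_borel_integral_eq_integral(2)[OF this] show ?thesis
    using integral_unique[OF assms(2)] by (simp add: set_lebesgue_integral_def eq)
qed

lemma integrable_monomials_jacobi_weight:
  assumes "\<alpha> \<ge> 0" "\<beta> \<ge> 0" "t \<ge> 0"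
  shows "integrable lborel (\<lambda>x. x ^ i * (x - 1) ^ j * jacobi_weight \<alpha> \<beta> t x)"
proof (rule integrable_jacobi_weight[OF _ _ assms])
  fix x :: real assume "x \<in> {0..1}"
  hence "\<bar>x\<bar> ^ i * \<bar>x - 1\<bar> ^ j \<le> 1 * 1" by (intro mult_mono power_le_one) auto
  thus "\<bar>x ^ i * (x - 1) ^ j\<bar> \<le> 1" by (simp add: abs_mult power_abs)
qed measurable

section \<open>The multiple integral as a determinant of moments\<close>

definition Dn_integrand :: "real \<Rightarrow> real \<Rightarrow> nat \<Rightarrow> real \<Rightarrow> (nat \<Rightarrow> real) \<Rightarrow> real" where
  "Dn_integrand \<alpha> \<beta> n t x = (\<Prod>j<n. \<Prod>i<j. x j - x i)\<^sup>2 * (\<Prod>k<n. jacobi_weight \<alpha> \<beta> t (x k))"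

lemma Dn_conv_integrand:
  "Dn \<alpha> \<beta> n t = (\<integral>x. Dn_integrand \<alpha> \<beta> n t x \<partial>PiM {..<n} (\<lambda>_. lborel)) / fact n"
proof -
  have ind: "indicator {x. \<forall>i<n. x i \<in> {t..1}} x = (\<Prod>k<n. indicator {t..1} (x k) :: real)" for x :: "nat \<Rightarrow> real"
    by (auto simp: indicator_def intro!: prod_zero[symmetric])
  show ?thesis
    unfolding Dn_def Dn_integrand_def jacobi_weight_def ind
    by (simp add: prod.distrib prod_power_distrib mult_ac)
qed

text \<open>The Vandermonde product is the determinant of every monic family at the nodes, so the
  two families can be chosen independently to make the entries explicit.\<close>

lemma Dn_eq_det:
  fixes p q :: "nat \<Rightarrow> real poly"
  assumes p: "\<And>j. j < n \<Longrightarrow> degree (p j) \<le> j" "\<And>j. j < n \<Longrightarrow> coeff (p j) j = 1"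
    and q: "\<And>j. j < n \<Longrightarrow> degree (q j) \<le> j" "\<And>j. j < n \<Longrightarrow> coeff (q j) j = 1"
    and int: "\<And>i j. i < n \<Longrightarrow> j < n \<Longrightarrow> integrable lborel (\<lambda>x. poly (p i) x * poly (q j) x * jacobi_weight \<alpha> \<beta> t x)"
  shows "integrable (PiM {..<n} (\<lambda>_. lborel)) (Dn_integrand \<alpha> \<beta> n t)"
    and "Dn \<alpha> \<beta> n t = det (mat n n (\<lambda>(i, j). \<integral>x. poly (p i) x * poly (q j) x * jacobi_weight \<alpha> \<beta> t x \<partial>lborel))"
proof -
  have eq: "Dn_integrand \<alpha> \<beta> n t = (\<lambda>x. det (mat n n (\<lambda>(k, i). poly (p i) (x k))) *
      det (mat n n (\<lambda>(k, j). poly (q j) (x k))) * (\<Prod>k<n. jacobi_weight \<alpha> \<beta> t (x k)))"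
  proof
    fix x :: "nat \<Rightarrow> real"
    have "det (mat n n (\<lambda>(k, i). poly (p i) (x k))) = (\<Prod>j<n. \<Prod>i<j. x j - x i)"
      by (rule det_monic_polys) (use p in auto)
    moreover have "det (mat n n (\<lambda>(k, i). poly (q i) (x k))) = (\<Prod>j<n. \<Prod>i<j. x j - x i)"
      by (rule det_monic_polys) (use q in auto)
    ultimately show "Dn_integrand \<alpha> \<beta> n t x = det (mat n n (\<lambda>(k, i). poly (p i) (x k))) *
      det (mat n n (\<lambda>(k, j). poly (q j) (x k))) * (\<Prod>k<n. jacobi_weight \<alpha> \<beta> t (x k))"
      by (simp add: Dn_integrand_def power2_eq_square)
  qed
  show "integrable (PiM {..<n} (\<lambda>_. lborel)) (Dn_integrand \<alpha> \<beta> n t)"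
    unfolding eq by (rule lborel.andreief(1)[OF int])
  show "Dn \<alpha> \<beta> n t = det (mat n n (\<lambda>(i, j). \<integral>x. poly (p i) x * poly (q j) x * jacobi_weight \<alpha> \<beta> t x \<partial>lborel))"
    unfolding Dn_conv_integrand eq using lborel.andreief(2)[OF int] by simp
qed

lemma monic_linear_power:
  fixes a :: real
  shows "degree ([:a, 1:] ^ j) \<le> j" "coeff ([:a, 1:] ^ j) j = 1"
  using lead_coeff_power[of "[:a, 1:]" j] by (simp_all add: degree_linear_power)

lemma integrable_Dn_integrand:
  assumes "\<alpha> \<ge> 0" "\<beta> \<ge> 0" "t \<ge> 0"
  shows "integrable (PiM {..<n} (\<lambda>_. lborel)) (Dn_integrand \<alpha> \<beta> n t)"
  by (rule Dn_eq_det(1)[of n "\<lambda>i. [:0, 1:] ^ i" "\<lambda>j. [:- 1, 1:] ^ j"])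
     (use integrable_monomials_jacobi_weight[OF assms] in \<open>simp_all add: monic_linear_power\<close>)

text \<open>Reversing both index orders turns the entries into rising factorials of length j. Their
  largest factor, \<open>y i\<close>, is free of j, so column j holds a monic polynomial of degree j
  at the nodes \<open>y i\<close>; these have step -1, which gives the signs and factorials.\<close>

lemma det_inverse_Gamma_matrix:
  assumes "c > 0"
  shows "det (mat n n (\<lambda>(i, j). Gamma (c + real n - 1 + real i) / Gamma (c + real i + real j))) =
           (\<Prod>j<n. (-1) ^ j * fact j)"
proof -
  define E where "E = (\<lambda>i j. Gamma (c + real n - 1 + real i) / Gamma (c + real i + real j))"
  define y where "y = (\<lambda>i. c + 2 * real n - 3 - real i)"
  have *: "E (n - 1 - i) (n - 1 - j) = poly (newton_poly real j) (y i)" if "i < n" "j < n" for i j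
  proof -
    define a where "a = c + real (n - 1 - i) + real (n - 1 - j)"
    have a: "a > 0" using assms by (simp add: a_def)
    have "E (n - 1 - i) (n - 1 - j) = Gamma (a + real j) / Gamma a"
      using that by (simp add: E_def a_def of_nat_diff algebra_simps)
    also have "\<dots> = pochhammer a j"
      using a by (intro pochhammer_Gamma[symmetric]) (auto dest!: nonpos_Ints_nonpos)
    also have "\<dots> = (\<Prod>l<j. a + real (j - Suc l))"
      unfolding pochhammer_prod atLeast0LessThan by (rule prod.nat_diff_reindex[symmetric])
    also have "\<dots> = (\<Prod>l<j. y i - real l)"
      using that by (intro prod.cong) (auto simp: a_def y_def of_nat_diff)
    finally show ?thesis by (simp add: poly_newton_poly)
  qed
  have "det (mat n n (\<lambda>(i, j). E i j)) = det (mat n n (\<lambda>(i, j). E (n - 1 - i) (n - 1 - j)))"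
    by (rule det_reverse[symmetric])
  also have "mat n n (\<lambda>(i, j). E (n - 1 - i) (n - 1 - j)) = mat n n (\<lambda>(i, j). poly (newton_poly real j) (y i))"
    by (rule eq_matI) (simp_all only: index_mat dim_row_mat dim_col_mat split *)
  also have "det \<dots> = (\<Prod>j<n. \<Prod>i<j. y j - y i)"
    by (rule det_monic_polys) (simp_all add: degree_le coeff_newton_poly_gt coeff_newton_poly_self)
  also have "\<dots> = (\<Prod>j<n. (-1) ^ j * fact j)"
  proof (rule prod.cong)
    fix j
    have "(\<Prod>i<j. y j - y i) = (\<Prod>i<j. - 1 * real (j - i))"
      by (rule prod.cong) (auto simp: y_def of_nat_diff)
    also have "\<dots> = (-1) ^ j * (\<Prod>i<j. real (j - i))"
      unfolding prod.distrib by simp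
    also have "(\<Prod>i<j. real (j - i)) = fact j"
      by (simp add: fact_prod_rev atLeast0LessThan)
    finally show "(\<Prod>i<j. y j - y i) = (-1) ^ j * fact j" .
  qed simp
  finally show ?thesis by (simp add: E_def)
qed

theorem Dn_0:
  assumes "\<alpha> \<ge> 0" "\<beta> \<ge> 0"
  shows "Dn \<alpha> \<beta> n 0 = selberg_prod \<alpha> \<beta> n"
proof -
  define c where "c = \<alpha> + \<beta> + 2"
  \<comment> \<open>The Beta denominator Gamma(c+i+j) is the only part that does not split into row
    and column factors. The Gamma value divided out here reappears in the numerator of
    \<open>E\<close>, where it makes each entry a finite product.\<close>
  define r where "r = (\<lambda>i. Gamma (\<alpha> + 1 + real i) / Gamma (c + real n - 1 + real i))"
  define s where "s = (\<lambda>j. (-1) ^ j * Gamma (\<beta> + 1 + real j))"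
  define E where "E = (\<lambda>i j. Gamma (c + real n - 1 + real i) / Gamma (c + real i + real j))"
  have m: "(\<integral>x. x ^ i * (x - 1) ^ j * jacobi_weight \<alpha> \<beta> 0 x \<partial>lborel) = r i * s j * E i j" if "i < n" for i j
  proof -
    have "((\<lambda>x. (-1) ^ j * (x powr (\<alpha> + 1 + real i - 1) * (1 - x) powr (\<beta> + 1 + real j - 1))) has_integral
             (-1) ^ j * Beta (\<alpha> + 1 + real i) (\<beta> + 1 + real j)) {0..1}"
      using assms by (intro has_integral_mult_right has_integral_Beta_real) auto
    also have "?this \<longleftrightarrow> ((\<lambda>x. x ^ i * (x - 1) ^ j * (x powr \<alpha> * (1 - x) powr \<beta>)) has_integral
             (-1) ^ j * Beta (\<alpha> + 1 + real i) (\<beta> + 1 + real j)) {0..1}"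
    proof (rule has_integral_cong)
      fix x :: real assume x: "x \<in> {0..1}"
      \<comment> \<open>At u = 0 both sides vanish, as \<open>0 powr a\<close> is 0 for every a,
        including a = 0.\<close>
      have pw: "u powr (a + real k) = u powr a * u ^ k" if "u \<ge> 0" for u a :: real and k
        using that by (cases "u = 0") (simp_all add: powr_add powr_realpow)
      have "(x - 1) ^ j = (-1) ^ j * (1 - x) ^ j"
        by (simp add: power_mult_distrib[symmetric])
      thus "(-1) ^ j * (x powr (\<alpha> + 1 + real i - 1) * (1 - x) powr (\<beta> + 1 + real j - 1)) =
          x ^ i * (x - 1) ^ j * (x powr \<alpha> * (1 - x) powr \<beta>)"
        using x pw[of x \<alpha> i] pw[of "1 - x" \<beta> j] by (simp add: algebra_simps)
    qed
    finally have "(\<integral>x. x ^ i * (x - 1) ^ j * jacobi_weight \<alpha> \<beta> 0 x \<partial>lborel) = 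
        (-1) ^ j * Beta (\<alpha> + 1 + real i) (\<beta> + 1 + real j)"
      using assms by (intro integral_jacobi_weight integrable_monomials_jacobi_weight) auto
    moreover have "Gamma (c + real n - 1 + real i) > 0"
      using that assms by (intro Gamma_real_pos) (simp add: c_def)
    ultimately show ?thesis
      by (simp add: Beta_def r_def s_def E_def c_def algebra_simps)
  qed
  have "Dn \<alpha> \<beta> n 0 = det (mat n n (\<lambda>(i, j). \<integral>x. poly ([:0, 1:] ^ i) x * poly ([:- 1, 1:] ^ j) x * jacobi_weight \<alpha> \<beta> 0 x \<partial>lborel))"
    by (rule Dn_eq_det(2))
     (use integrable_monomials_jacobi_weight[OF assms] in \<open>simp_all add: monic_linear_power\<close>)
  also have "mat n n (\<lambda>(i, j). \<integral>x. poly ([:0, 1:] ^ i) x * poly ([:- 1, 1:] ^ j) x * jacobi_weight \<alpha> \<beta> 0 x \<partial>lborel)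
      = mat n n (\<lambda>(i, j). r i * s j * E i j)"
    by (rule eq_matI) (simp_all add: m[symmetric])
  also have "det \<dots> = (\<Prod>i<n. r i) * (\<Prod>j<n. s j) * (\<Prod>j<n. (-1) ^ j * fact j)"
    unfolding det_scale_rows_cols unfolding E_def using assms by (subst det_inverse_Gamma_matrix) (auto simp: c_def)
  also have "\<dots> = (\<Prod>j<n. r j * s j * ((-1) ^ j * fact j))"
    by (simp only: prod.distrib)
  also have "\<dots> = selberg_prod \<alpha> \<beta> n"
    unfolding selberg_prod_def
  proof (rule prod.cong)
    fix j
    have "(-1) ^ j * (-1) ^ j = (1 :: real)" by (simp add: power_mult_distrib[symmetric])
    thus "r j * s j * ((-1) ^ j * fact j) = fact j * Gamma (\<alpha> + 1 + real j) * Gamma (\<beta> + 1 + real j) /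
         Gamma (\<alpha> + \<beta> + 1 + real n + real j)"
      by (simp add: r_def s_def c_def algebra_simps)
  qed simp
  finally show ?thesis .
qed

text \<open>For \<alpha> = 0 the integrand is a pure power of 1 - x, so every entry is a row factor
  times a column factor times a number free of t. The determinant of \<open>H\<close> need not be
  evaluated: it occurs at t and at 0 alike.\<close>

lemma Dn_alpha_0_scaling:
  assumes "\<beta> \<ge> 0" "0 \<le> t" "t < 1"
  shows "Dn 0 \<beta> n t = (1 - t) powr (real n * (real n + \<beta>)) * Dn 0 \<beta> n 0"
proof -
  define H where "H = (\<lambda>i j. (-1) ^ (i + j) / (\<beta> + real (i + j) + 1))"
  have Dn_eq: "Dn 0 \<beta> n u = (\<Prod>i<n. (1 - u) ^ i) * (\<Prod>j<n. (1 - u) ^ j * (1 - u) powr (\<beta> + 1)) * det (mat n n (\<lambda>(i, j). H i j))"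
    if u: "0 \<le> u" "u < 1" for u
  proof -
    have m: "(\<integral>x. (x - 1) ^ (i + j) * jacobi_weight 0 \<beta> u x \<partial>lborel) =
        (1 - u) ^ i * ((1 - u) ^ j * (1 - u) powr (\<beta> + 1)) * H i j" for i j
    proof -
      define e where "e = \<beta> + real (i + j)"
      have e: "e \<ge> 0" using assms by (simp add: e_def)
      have "((\<lambda>x. (-1) ^ (i + j) * (1 - x) powr e) has_integral
          (- ((-1) ^ (i + j)) * (1 - 1) powr (e + 1) / (e + 1) - (- ((-1) ^ (i + j)) * (1 - u) powr (e + 1) / (e + 1)))) {u..1}"
      \<comment> \<open>The base 1 - x vanishes at the endpoint 1, so the derivative is taken in the
        open interval and only continuity is used at the ends.\<close>
      proof (rule fundamental_theorem_of_calculus_interior)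
        show "u \<le> 1" using u by simp
        show "continuous_on {u..1} (\<lambda>x. - ((-1) ^ (i + j)) * (1 - x) powr (e + 1) / (e + 1))"
          using e by (intro continuous_intros continuous_on_powr') auto
        fix x assume x: "x \<in> {u<..<1}"
        have "((\<lambda>x. (1 - x) powr (e + 1)) has_real_derivative (e + 1) * (1 - x) powr (e + 1 - of_nat 1) * (- 1)) (at x)"
          using x by (intro DERIV_fun_powr) (auto intro!: derivative_eq_intros)
        from DERIV_cdivide[OF DERIV_cmult[OF this, of "- ((-1) ^ (i + j))"], of "e + 1"]
        show "((\<lambda>x. - ((-1) ^ (i + j)) * (1 - x) powr (e + 1) / (e + 1)) has_vector_derivative (-1) ^ (i + j) * (1 - x) powr e) (at x)"
          unfolding has_real_derivative_iff_has_vector_derivative[symmetric] using e by simp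
      qed
      hence "((\<lambda>x. (-1) ^ (i + j) * (1 - x) powr e) has_integral (-1) ^ (i + j) * (1 - u) powr (e + 1) / (e + 1)) {u..1}"
        by simp
      hence "((\<lambda>x. (x - 1) ^ (i + j) * (x powr 0 * (1 - x) powr \<beta>)) has_integral (-1) ^ (i + j) * (1 - u) powr (e + 1) / (e + 1)) {u..1}"
        \<comment> \<open>the two functions differ at 0, where \<^term>\<open>(0::real) powr 0 = 0\<close>\<close>
        \<comment> \<open>the two functions differ at 0, where \<^term>\<open>(0::real) powr 0 = 0\<close>\<close>
      proof (rule has_integral_spike_finite[of "{0, 1}", rotated 2])
        fix x assume x: "x \<in> {u..1} - {0, 1}"
        have "(x - 1) ^ (i + j) = (-1) ^ (i + j) * (1 - x) ^ (i + j)"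
          by (simp add: power_mult_distrib[symmetric])
        moreover have "(1 - x) powr e = (1 - x) powr \<beta> * (1 - x) ^ (i + j)"
          unfolding e_def powr_add using x by (subst powr_realpow) auto
        ultimately show "(x - 1) ^ (i + j) * (x powr 0 * (1 - x) powr \<beta>) = (-1) ^ (i + j) * (1 - x) powr e"
          using x by simp
      qed simp
      hence "(\<integral>x. (x - 1) ^ (i + j) * jacobi_weight 0 \<beta> u x \<partial>lborel) = (-1) ^ (i + j) * (1 - u) powr (e + 1) / (e + 1)"
        using integrable_monomials_jacobi_weight[of 0 \<beta> u 0 "i + j"] assms u
        by (intro integral_jacobi_weight) auto
      moreover have "(1 - u) powr (e + 1) = (1 - u) ^ i * ((1 - u) ^ j * (1 - u) powr (\<beta> + 1))"
      proof -
        have "(1 - u) powr (e + 1) = (1 - u) powr (real (i + j) + (\<beta> + 1))" by (simp add: e_def algebra_simps)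
        also have "\<dots> = (1 - u) ^ (i + j) * (1 - u) powr (\<beta> + 1)"
          unfolding powr_add[of _ "real (i + j)"] using u by (subst powr_realpow) auto
        finally show ?thesis by (simp add: power_add)
      qed
      ultimately show ?thesis by (simp add: H_def e_def)
    qed
    have "Dn 0 \<beta> n u = det (mat n n (\<lambda>(i, j). \<integral>x. poly ([:- 1, 1:] ^ i) x * poly ([:- 1, 1:] ^ j) x * jacobi_weight 0 \<beta> u x \<partial>lborel))"
    proof (rule Dn_eq_det(2))
      fix i j
      show "integrable lborel (\<lambda>x. poly ([:- 1, 1:] ^ i) x * poly ([:- 1, 1:] ^ j) x * jacobi_weight 0 \<beta> u x)"
        using integrable_monomials_jacobi_weight[of 0 \<beta> u 0 "i + j"] assms u by (simp add: power_add)
    qed (simp_all add: monic_linear_power)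
    also have "mat n n (\<lambda>(i, j). \<integral>x. poly ([:- 1, 1:] ^ i) x * poly ([:- 1, 1:] ^ j) x * jacobi_weight 0 \<beta> u x \<partial>lborel)
        = mat n n (\<lambda>(i, j). (1 - u) ^ i * ((1 - u) ^ j * (1 - u) powr (\<beta> + 1)) * H i j)"
      by (rule eq_matI) (simp_all add: m[symmetric] power_add)
    finally show ?thesis by (simp only: det_scale_rows_cols)
  qed
  \<comment> \<open>The exponents add up to k(k-1) + k(\<beta>+1) = k(k+\<beta>).\<close>
  have pw: "(\<Prod>i<k. (1 - t) ^ i) * (\<Prod>j<k. (1 - t) ^ j * (1 - t) powr (\<beta> + 1)) = (1 - t) powr (real k * (real k + \<beta>))" for k
  proof (induction k)
    case 0
    show ?case using assms by simp
  next
    case (Suc k)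
    have "(\<Prod>i<Suc k. (1 - t) ^ i) * (\<Prod>j<Suc k. (1 - t) ^ j * (1 - t) powr (\<beta> + 1)) =
      ((\<Prod>i<k. (1 - t) ^ i) * (\<Prod>j<k. (1 - t) ^ j * (1 - t) powr (\<beta> + 1))) * ((1 - t) ^ k * (1 - t) ^ k * (1 - t) powr (\<beta> + 1))"
      by (simp only: prod.lessThan_Suc mult_ac)
    also have "\<dots> = (1 - t) powr (real k * (real k + \<beta>) + real k + real k + (\<beta> + 1))"
      unfolding Suc unfolding powr_add using assms by (simp add: powr_realpow)
    also have "real k * (real k + \<beta>) + real k + real k + (\<beta> + 1) = real (Suc k) * (real (Suc k) + \<beta>)"
      by (simp add: algebra_simps)
    finally show ?case .
  qed
  \<comment> \<open>At u = 0 all scaling factors are 1, which identifies the determinant of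
    \<open>H\<close> with \<open>Dn 0 \<beta> n 0\<close>.\<close>
  show ?thesis unfolding Dn_eq[OF assms(2,3)] pw by (subst Dn_eq) simp_all
qed

section \<open>Comparison with the case \<alpha> = 0 and the limit at 1\<close>

lemma Dn_squeeze:
  assumes "\<alpha> \<ge> 0" "\<beta> \<ge> 0" "0 < t" "t < 1"
  shows "t powr (real n * \<alpha>) * Dn 0 \<beta> n t \<le> Dn \<alpha> \<beta> n t" and "Dn \<alpha> \<beta> n t \<le> Dn 0 \<beta> n t"
proof -
  \<comment> \<open>The two weights differ by the factor x^\<alpha>, which lies between t^\<alpha>
    and 1 on [t, 1]; multiplying over n coordinates yields the exponent n \<alpha>.\<close>
  have *: "t powr \<alpha> * jacobi_weight 0 \<beta> t x \<le> jacobi_weight \<alpha> \<beta> t x \<and> jacobi_weight \<alpha> \<beta> t x \<le> jacobi_weight 0 \<beta> t x" for x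
  proof (cases "x \<in> {t..1}")
    case True
    hence "t powr \<alpha> \<le> x powr \<alpha>" "x powr \<alpha> \<le> 1" using assms by (auto intro: powr_mono2 powr_le1)
    thus ?thesis using True assms by (auto simp: jacobi_weight_def intro!: mult_right_mono mult_left_le_one_le)
  qed (simp add: jacobi_weight_def)
  have pw: "t powr (real n * \<alpha>) = (\<Prod>k<n. t powr \<alpha>)" using assms by (simp add: powr_power mult.commute)
  have 1: "t powr (real n * \<alpha>) * Dn_integrand 0 \<beta> n t x \<le> Dn_integrand \<alpha> \<beta> n t x" for x
  proof -
    have "(\<Prod>k<n. t powr \<alpha> * jacobi_weight 0 \<beta> t (x k)) \<le> (\<Prod>k<n. jacobi_weight \<alpha> \<beta> t (x k))"
      using * by (intro prod_mono) (simp add: jacobi_weight_nonneg)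
    from mult_left_mono[OF this zero_le_power2[of "\<Prod>j<n. \<Prod>i<j. x j - x i"]] show ?thesis
      unfolding Dn_integrand_def pw prod.distrib by (simp only: mult_ac)
  qed
  have 2: "Dn_integrand \<alpha> \<beta> n t x \<le> Dn_integrand 0 \<beta> n t x" for x
    unfolding Dn_integrand_def using * by (intro mult_left_mono prod_mono) (simp_all add: jacobi_weight_nonneg)
  have int: "integrable (PiM {..<n} (\<lambda>_. lborel)) (Dn_integrand a \<beta> n t)" if "a \<ge> 0" for a
    using that assms by (intro integrable_Dn_integrand) auto
  have "t powr (real n * \<alpha>) * (\<integral>x. Dn_integrand 0 \<beta> n t x \<partial>PiM {..<n} (\<lambda>_. lborel)) =
      (\<integral>x. t powr (real n * \<alpha>) * Dn_integrand 0 \<beta> n t x \<partial>PiM {..<n} (\<lambda>_. lborel))" by simp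
  also have "\<dots> \<le> (\<integral>x. Dn_integrand \<alpha> \<beta> n t x \<partial>PiM {..<n} (\<lambda>_. lborel))"
    using assms by (intro integral_mono integrable_mult_right int 1) auto
  finally show "t powr (real n * \<alpha>) * Dn 0 \<beta> n t \<le> Dn \<alpha> \<beta> n t"
    by (simp add: Dn_conv_integrand divide_right_mono)
  show "Dn \<alpha> \<beta> n t \<le> Dn 0 \<beta> n t"
    unfolding Dn_conv_integrand using assms by (intro divide_right_mono integral_mono int 2) auto
qed

theorem theorem1p2:
  fixes \<alpha> \<beta> :: real and n :: nat
  assumes "\<alpha> > 0" and "\<beta> > 0" and "n \<ge> 1"
  shows "((\<lambda>t. (Dn \<alpha> \<beta> n t / Dn \<alpha> \<beta> n 0) /
            (2 powr (2 * real n * \<alpha>) * (Ffun 0 \<beta> * Kfun 0 \<beta> n) / (Ffun \<alpha> \<beta> * Kfun \<alpha> \<beta> n)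
             * (1 - t) powr (real n * (real n + \<beta>))))
         \<longlongrightarrow> 1) (at_left 1)"
proof -
  define C where "C = 2 powr (2 * real n * \<alpha>) * (Ffun 0 \<beta> * Kfun 0 \<beta> n) / (Ffun \<alpha> \<beta> * Kfun \<alpha> \<beta> n)"
  have pos: "Dn 0 \<beta> n 0 > 0" "Dn \<alpha> \<beta> n 0 > 0"
    using assms by (auto simp: Dn_0 intro!: selberg_prod_pos)
  \<comment> \<open>By \<open>Ffun_Kfun\<close> and \<open>Dn_0\<close> the common product
    \<open>Q\<close> cancels, and the remaining powers of 2 differ by exactly the prefactor 2^(2 n
    \<alpha>).\<close>
  have C: "C = Dn 0 \<beta> n 0 / Dn \<alpha> \<beta> n 0"
  proof -
    have pw: "2 powr (2 * real n * (\<alpha> + \<beta> + 1)) = 2 powr (2 * real n * \<alpha>) * (2 powr (2 * real n * (0 + \<beta> + 1)) :: real)"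
      by (simp add: powr_add[symmetric] algebra_simps)
    define Q where "Q = (\<Prod>j<n. 2 ^ (4 * j) / (2 * pi))"
    have "Q > 0" unfolding Q_def by (intro prod_pos) auto
    moreover have "Ffun 0 \<beta> * Kfun 0 \<beta> n = Dn 0 \<beta> n 0 * 2 powr (2 * real n * (0 + \<beta> + 1)) * Q"
      using assms by (simp add: Ffun_Kfun Dn_0 Q_def)
    moreover have "Ffun \<alpha> \<beta> * Kfun \<alpha> \<beta> n =
        Dn \<alpha> \<beta> n 0 * (2 powr (2 * real n * \<alpha>) * 2 powr (2 * real n * (0 + \<beta> + 1))) * Q"
      unfolding pw[symmetric] using assms by (simp add: Ffun_Kfun Dn_0 Q_def)
    ultimately show ?thesis using pos by (simp add: C_def)
  qed
  \<comment> \<open>\<open>C\<close> times the power of 1 - t is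
    \<open>Dn 0 \<beta> n t / Dn \<alpha> \<beta> n 0\<close> by the exact scaling, so the
    normalisation at 0 drops out.\<close>
  have eq: "(Dn \<alpha> \<beta> n t / Dn \<alpha> \<beta> n 0) / (C * (1 - t) powr (real n * (real n + \<beta>))) = Dn \<alpha> \<beta> n t / Dn 0 \<beta> n t"
    if "0 < t" "t < 1" for t
    using that assms pos by (subst Dn_alpha_0_scaling[of \<beta> t n]) (auto simp: C field_simps)
  have Dn_pos: "Dn 0 \<beta> n t > 0" if "0 < t" "t < 1" for t
    using that assms pos by (subst Dn_alpha_0_scaling) auto
  have ev: "\<forall>\<^sub>F t in at_left 1. 0 < t \<and> t < (1 :: real)"
    using eventually_at_left_real[of 0 1] by (auto elim: eventually_mono)
  have "((\<lambda>t. Dn \<alpha> \<beta> n t / Dn 0 \<beta> n t) \<longlongrightarrow> 1) (at_left 1)"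
  proof (rule tendsto_sandwich)
    show "\<forall>\<^sub>F t in at_left 1. t powr (real n * \<alpha>) \<le> Dn \<alpha> \<beta> n t / Dn 0 \<beta> n t"
      using ev by eventually_elim (use Dn_squeeze(1) Dn_pos assms in \<open>auto simp: pos_le_divide_eq\<close>)
    show "\<forall>\<^sub>F t in at_left 1. Dn \<alpha> \<beta> n t / Dn 0 \<beta> n t \<le> 1"
      using ev by eventually_elim (use Dn_squeeze(2) Dn_pos assms in \<open>auto simp: pos_divide_le_eq\<close>)
    have "((\<lambda>t. t powr (real n * \<alpha>)) \<longlongrightarrow> 1 powr (real n * \<alpha>)) (at_left (1 :: real))"
      by (intro tendsto_intros) auto
    thus "((\<lambda>t. t powr (real n * \<alpha>)) \<longlongrightarrow> 1) (at_left (1 :: real))" by simp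
  qed simp
  hence "((\<lambda>t. (Dn \<alpha> \<beta> n t / Dn \<alpha> \<beta> n 0) / (C * (1 - t) powr (real n * (real n + \<beta>)))) \<longlongrightarrow> 1) (at_left 1)"
    by (rule Lim_transform_eventually) (use ev in \<open>auto elim!: eventually_mono simp only: eq\<close>)
  thus ?thesis unfolding C_def .
qed

end
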